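(* Let $D$ be a bounded convex open subset of $\mathbb R^N$. If a sequence $(x_n)$ in $D$ converges to a horofunction of the Hilbert geometry on $D$, then $(x_n)$ converges in the usual (Euclidean) sense to a point of the Euclidean boundary $\partial D$.
   Context: Hilbert distance on $D$: for distinct $x,y\in D$, let $w,z\in\partial D$ be such that $w,x,y,z$ are collinear in this order; then $d_H(x,y):=\log\frac{|zx|\,|wy|}{|zy|\,|wx|}$, and $d_H(x,x)=0$. Fix a basepoint $b\in D$. A sequence $(x_n)$ in $D$ converges to $g:D\to\mathbb R$ if $d_H(\cdot,x_n)-d_H(b,x_n)\to g$ pointwise on $D$; a horofunction is a function $g$ obtained as such a limit of some sequence which is not of the form $d_H(\cdot,p)-d_H(b,p)$ with $p\in D$. *)

theory Defs
  imports "HOL-Analysis.Analysis"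
begin

definition hilbert_dist :: "'a::euclidean_space set \<Rightarrow> 'a \<Rightarrow> 'a \<Rightarrow> real" where
  "hilbert_dist D x y =
     (if x = y then 0 else
       (case (THE (w, z). w \<in> frontier D \<and> z \<in> frontier D \<and>
                x \<in> open_segment w y \<and> y \<in> open_segment x z) of
         (w, z) \<Rightarrow> ln ((dist z x * dist w y) / (dist z y * dist w x))))"

definition hilbert_converges_to ::
    "'a::euclidean_space set \<Rightarrow> 'a \<Rightarrow> (nat \<Rightarrow> 'a) \<Rightarrow> ('a \<Rightarrow> real) \<Rightarrow> bool" where
  "hilbert_converges_to D b xs g \<longleftrightarrow>
     (\<forall>y\<in>D. ((\<lambda>n. hilbert_dist D y (xs n) - hilbert_dist D b (xs n)) \<longlongrightarrow> g y) sequentially)"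

definition horofunction :: "'a::euclidean_space set \<Rightarrow> 'a \<Rightarrow> ('a \<Rightarrow> real) \<Rightarrow> bool" where
  "horofunction D b g \<longleftrightarrow>
     (\<exists>xs. (\<forall>n. xs n \<in> D) \<and> hilbert_converges_to D b xs g) \<and>
     \<not> (\<exists>p\<in>D. \<forall>y\<in>D. g y = hilbert_dist D y p - hilbert_dist D b p)"

end

theory Submission
  imports Defs
begin

text \<open>
  With \<open>A\<close> the polar body of \<open>D - b\<close> and \<open>f\<^sub>a x = 1 - a \<bullet> (x - b)\<close>, put
  \<open>M x y = sup {f\<^sub>a x / f\<^sub>a y | a \<in> A}\<close>; then the Hilbert distance is \<open>ln (M x y * M y x)\<close>.
  An interior limit point of \<open>x\<^sub>n\<close> would make the limit function a distance function. Suppose that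
  two subsequences tend to boundary points \<open>\<xi>\<close> and \<open>\<eta>\<close>. Evaluating \<open>g\<close> at
  \<open>y = (1 - t) b + t \<xi>\<close>, the first subsequence gives \<open>exp (g y) \<le> (1 - t) / (t * M \<xi> b)\<close>
  and the second one gives \<open>exp (g y) \<ge> (1 - t) * M \<eta> y / M \<eta> b\<close>.
  Letting \<open>t\<close> tend to 1 yields \<open>f\<^sub>a \<eta> * M \<xi> b \<le> f\<^sub>a \<xi> * M \<eta> b\<close> for all \<open>a \<in> A\<close>.
  By symmetry equality holds; \<open>a = 0\<close> shows \<open>M \<xi> b = M \<eta> b\<close>, so all \<open>f\<^sub>a\<close> agree at
  \<open>\<xi>\<close> and \<open>\<eta>\<close>, and \<open>\<xi> = \<eta>\<close> because \<open>A\<close> is a neighbourhood of 0.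
\<close>

section \<open>Polar body and normalised affine functionals\<close>

definition polar_at :: "'a::euclidean_space set \<Rightarrow> 'a \<Rightarrow> 'a set" where
  "polar_at D b = {a. \<forall>x\<in>D. a \<bullet> (x - b) \<le> 1}"

text \<open>For \<open>a \<noteq> 0\<close> this is the signed distance of \<open>x\<close> to the
  hyperplane \<open>a \<bullet> (x - b) = 1\<close>, scaled so as to be 1 at
  \<open>b\<close>.\<close>

definition gap :: "'a::euclidean_space \<Rightarrow> 'a \<Rightarrow> 'a \<Rightarrow> real" where
  "gap b a x = 1 - a \<bullet> (x - b)"

text \<open>On \<open>D\<close> this is the exponential of the Funk metric. Written as a supremum
  over functionals it extends to frontier points \<open>x\<close>, which chord ratios would not do
  directly.\<close>

definition gap_ratio :: "'a::euclidean_space set \<Rightarrow> 'a \<Rightarrow> 'a \<Rightarrow> 'a \<Rightarrow> real" where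
  "gap_ratio D b x y = (SUP a\<in>polar_at D b. gap b a x / gap b a y)"

lemma gap_base [simp]: "gap b a b = 1"
  by (simp add: gap_def)

lemma gap_zero [simp]: "gap b 0 x = 1"
  by (simp add: gap_def)

lemma zero_in_polar_at [simp]: "0 \<in> polar_at D b"
  by (simp add: polar_at_def)

lemma gap_affine: "gap b a ((1 - t) *\<^sub>R x + t *\<^sub>R y) = (1 - t) * gap b a x + t * gap b a y"
  by (simp add: gap_def algebra_simps)

lemma gap_diff_le: "\<bar>gap b a x - gap b a y\<bar> \<le> norm a * norm (x - y)"
proof -
  have "gap b a x - gap b a y = - (a \<bullet> (x - y))"
    by (simp add: gap_def algebra_simps)
  then show ?thesis
    using Cauchy_Schwarz_ineq2[of a "x - y"] by simp
qed

lemma continuous_gap: "continuous_on UNIV (gap b a)"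
  unfolding gap_def by (intro continuous_intros)

context
  fixes D :: "'a::euclidean_space set" and b :: 'a
  assumes bounded: "bounded D" and convex: "convex D" and "open": "open D" and base: "b \<in> D"
begin

lemma gap_nonneg:
  assumes "a \<in> polar_at D b" "x \<in> closure D"
  shows "0 \<le> gap b a x"
proof -
  obtain s where s: "\<And>n. s n \<in> D" "s \<longlonglongrightarrow> x"
    using assms(2) closure_sequential by blast
  have lim: "(\<lambda>n. gap b a (s n)) \<longlonglongrightarrow> gap b a x"
    using continuous_on_tendsto_compose[OF continuous_gap s(2)] by simp
  have "0 \<le> gap b a (s n)" for n
    using assms(1) s(1)[of n] by (simp add: gap_def polar_at_def)
  then show ?thesis by (intro LIMSEQ_le_const[OF lim]) simp
qed

text \<open>\<open>D\<close> contains a ball about \<open>b\<close>; testing \<open>a\<close> at the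
  point of that ball in direction \<open>a\<close> bounds its norm.\<close>

lemma polar_at_bounded: "\<exists>R>0. \<forall>a\<in>polar_at D b. norm a \<le> R"
proof -
  obtain r where r: "r > 0" "cball b r \<subseteq> D"
    using "open" base open_contains_cball by blast
  have "norm a \<le> 1 / r" if a: "a \<in> polar_at D b" for a
  proof (cases "a = 0")
    case False
    have "b + (r / norm a) *\<^sub>R a \<in> D"
      using r False by (intro subsetD[OF r(2)]) (simp add: dist_norm)
    then have "a \<bullet> ((r / norm a) *\<^sub>R a) \<le> 1"
      using a by (force simp: polar_at_def)
    then have "r * norm a \<le> 1"
      using False by (simp add: dot_square_norm power2_eq_square)
    then show ?thesis using r by (simp add: field_simps)
  qed (use r in simp)
  then show ?thesis using r by (intro exI[of _ "1 / r"]) auto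
qed

text \<open>Boundedness of \<open>D\<close> enters through Cauchy-Schwarz. In the end this makes the
  functionals rich enough to separate points.\<close>

lemma polar_at_neighbourhood: "\<exists>r>0. cball 0 r \<subseteq> polar_at D b"
proof -
  obtain B where B: "B > 0" "\<And>x. x \<in> D \<Longrightarrow> norm x \<le> B"
    using bounded bounded_pos by blast
  have "a \<bullet> (x - b) \<le> 1" if "norm a \<le> 1 / (2 * B)" "x \<in> D" for a x
  proof -
    have "norm (x - b) \<le> 2 * B"
      using B(2)[OF that(2)] B(2)[OF base] norm_triangle_ineq4[of x b] by linarith
    then have "norm a * norm (x - b) \<le> (1 / (2 * B)) * (2 * B)"
      using that B by (intro mult_mono) auto
    then show ?thesis
      using norm_cauchy_schwarz[of a "x - b"] B by simp
  qed
  then show ?thesis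
    using B by (intro exI[of _ "1 / (2 * B)"]) (auto simp: polar_at_def)
qed

text \<open>An interior point \<open>y\<close> can be pushed a little further away from
  \<open>b\<close> inside \<open>D\<close>. Nonnegativity at the pushed point gives a bound at
  \<open>y\<close> that is uniform in \<open>a\<close>.\<close>

lemma gap_lower_bound:
  assumes "y \<in> D"
  shows "\<exists>e>0. \<forall>a\<in>polar_at D b. e \<le> gap b a y"
proof -
  obtain r where r: "r > 0" "cball y r \<subseteq> D"
    using "open" assms open_contains_cball by blast
  \<comment> \<open>The summand 1 keeps the denominator positive when \<open>y = b\<close>.\<close>
  define s where "s = r / (norm (y - b) + 1)"
  have s: "s > 0" using r by (simp add: s_def add_nonneg_pos)
  have "s * norm (y - b) \<le> r"
    using r by (simp add: s_def divide_le_eq add_nonneg_pos mult_left_mono)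
  then have in_D: "y + s *\<^sub>R (y - b) \<in> D"
    using s by (intro subsetD[OF r(2)]) (simp add: dist_norm)
  have "s / (1 + s) \<le> gap b a y" if "a \<in> polar_at D b" for a
  proof -
    have "a \<bullet> (y + s *\<^sub>R (y - b) - b) \<le> 1"
      using that in_D by (auto simp: polar_at_def)
    moreover have "a \<bullet> (y + s *\<^sub>R (y - b) - b) = (1 + s) * (a \<bullet> (y - b))"
      by (simp add: algebra_simps)
    ultimately have "s \<le> (1 + s) * gap b a y"
      by (simp add: gap_def algebra_simps)
    then show ?thesis using s by (simp add: field_simps)
  qed
  then show ?thesis using s by (intro exI[of _ "s / (1 + s)"]) auto
qed

lemma gap_pos: "a \<in> polar_at D b \<Longrightarrow> y \<in> D \<Longrightarrow> 0 < gap b a y"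
  using gap_lower_bound by force

text \<open>A supporting hyperplane at \<open>z\<close> misses the interior point \<open>b\<close>,
  so its functional can be rescaled to be 1 at \<open>b\<close>.\<close>

lemma supporting_gap:
  assumes "z \<in> frontier D"
  obtains a where "a \<in> polar_at D b" "gap b a z = 0"
proof -
  have z: "z \<in> closure D" "z \<notin> rel_interior D"
    using assms rel_interior_open[OF "open"] interior_open[OF "open"] by (auto simp: frontier_def)
  obtain c where c: "\<And>y. y \<in> D \<Longrightarrow> c \<bullet> z \<le> c \<bullet> y" "\<And>y. y \<in> rel_interior D \<Longrightarrow> c \<bullet> z < c \<bullet> y"
    by (rule supporting_hyperplane_relative_frontier[OF convex z])
      (rule that, use closure_subset in blast)
  \<comment> \<open>With this scaling, \<open>gap b (- (c /\<^sub>R k)) x\<close> equals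
    \<open>(c \<bullet> x - c \<bullet> z) / k\<close>.\<close>
  define k where "k = c \<bullet> b - c \<bullet> z"
  have k: "k > 0" using c(2) base "open" by (simp add: k_def rel_interior_open)
  have "- (c /\<^sub>R k) \<in> polar_at D b"
    unfolding polar_at_def
  proof safe
    fix x assume "x \<in> D"
    then have "(c \<bullet> b - c \<bullet> x) / k \<le> 1"
      using c(1)[of x] k by (simp add: k_def)
    then show "- (c /\<^sub>R k) \<bullet> (x - b) \<le> 1"
      using k by (simp add: algebra_simps pos_divide_le_eq divide_simps)
  qed
  moreover have "c \<bullet> (z - b) = - k"
    by (simp add: k_def inner_diff_right)
  then have "gap b (- (c /\<^sub>R k)) z = 0"
    using k by (simp add: gap_def)
  ultimately show thesis using that by blast
qed

section \<open>Basic inequalities for the ratio supremum\<close>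

text \<open>Needed for the real supremum to be meaningful: numerators are bounded since the polar
  body is, and denominators stay away from 0 since \<open>y\<close> is interior.\<close>

lemma gap_ratio_bdd:
  assumes "x \<in> closure D" "y \<in> D"
  shows "bdd_above ((\<lambda>a. gap b a x / gap b a y) ` polar_at D b)"
proof -
  obtain R where R: "R > 0" "\<And>a. a \<in> polar_at D b \<Longrightarrow> norm a \<le> R"
    using polar_at_bounded by blast
  obtain e where e: "e > 0" "\<And>a. a \<in> polar_at D b \<Longrightarrow> e \<le> gap b a y"
    using gap_lower_bound[OF assms(2)] by blast
  have "gap b a x / gap b a y \<le> (1 + R * norm (x - b)) / e" if a: "a \<in> polar_at D b" for a
  proof -
    have "gap b a x \<le> 1 + norm a * norm (x - b)"
      using gap_diff_le[of b a x b] by simp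
    also have "\<dots> \<le> 1 + R * norm (x - b)"
      using R(2)[OF a] by (simp add: mult_right_mono)
    finally show ?thesis
      using e(1) e(2)[OF a] gap_nonneg[OF a assms(1)] by (intro frac_le) auto
  qed
  then show ?thesis by (auto simp: bdd_above_def)
qed

lemma gap_ratio_upper:
  "a \<in> polar_at D b \<Longrightarrow> x \<in> closure D \<Longrightarrow> y \<in> D \<Longrightarrow> gap b a x / gap b a y \<le> gap_ratio D b x y"
  unfolding gap_ratio_def by (intro cSUP_upper gap_ratio_bdd)

lemma gap_ratio_least:
  "(\<And>a. a \<in> polar_at D b \<Longrightarrow> gap b a x / gap b a y \<le> c) \<Longrightarrow> gap_ratio D b x y \<le> c"
  unfolding gap_ratio_def using zero_in_polar_at by (intro cSUP_least) blast+

lemma gap_ratio_ge_1: "x \<in> closure D \<Longrightarrow> y \<in> D \<Longrightarrow> 1 \<le> gap_ratio D b x y"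
  using gap_ratio_upper[of 0 x y] by simp

lemma gap_ratio_self: "y \<in> D \<Longrightarrow> gap_ratio D b y y = 1"
  using gap_ratio_ge_1[of y y] closure_subset[of D] gap_pos
  by (intro antisym gap_ratio_least) (force+)

text \<open>The multiplicative triangle inequality of the Funk metric: for each functional the ratio
  factors through \<open>y\<close>.\<close>

lemma gap_ratio_triangle:
  assumes "x \<in> closure D" "y \<in> D" "z \<in> D"
  shows "gap_ratio D b x z \<le> gap_ratio D b x y * gap_ratio D b y z"
proof (rule gap_ratio_least)
  fix a assume a: "a \<in> polar_at D b"
  have y: "y \<in> closure D" using assms closure_subset by auto
  have "gap b a x / gap b a z = (gap b a x / gap b a y) * (gap b a y / gap b a z)"
    using gap_pos[OF a assms(2)] by simp
  also have "\<dots> \<le> gap_ratio D b x y * gap_ratio D b y z"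
    using a assms y gap_ratio_ge_1[of x y] gap_nonneg[OF a y] gap_pos[OF a assms(3)]
    by (intro mult_mono gap_ratio_upper) auto
  finally show "gap b a x / gap b a z \<le> gap_ratio D b x y * gap_ratio D b y z" .
qed

lemma gap_ratio_convex:
  assumes "x \<in> closure D" "x' \<in> closure D" "y \<in> D" "0 \<le> t" "t \<le> 1"
  shows "gap_ratio D b ((1 - t) *\<^sub>R x + t *\<^sub>R x') y \<le> (1 - t) * gap_ratio D b x y + t * gap_ratio D b x' y"
proof (rule gap_ratio_least)
  fix a assume a: "a \<in> polar_at D b"
  have "gap b a ((1 - t) *\<^sub>R x + t *\<^sub>R x') / gap b a y
      = (1 - t) * (gap b a x / gap b a y) + t * (gap b a x' / gap b a y)"
    by (simp add: gap_affine add_divide_distrib)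
  also have "\<dots> \<le> (1 - t) * gap_ratio D b x y + t * gap_ratio D b x' y"
    using a assms by (intro add_mono mult_left_mono gap_ratio_upper) auto
  finally show "gap b a ((1 - t) *\<^sub>R x + t *\<^sub>R x') / gap b a y \<le> \<dots>" .
qed

text \<open>Each functional is nonnegative at \<open>x'\<close>, so the contribution of
  \<open>x'\<close> to the convex combination may be dropped.\<close>

lemma gap_ratio_scale_lower:
  assumes "x \<in> closure D" "x' \<in> closure D" "(1 - t) *\<^sub>R x + t *\<^sub>R x' \<in> closure D"
    "y \<in> D" "0 \<le> t" "t < 1"
  shows "(1 - t) * gap_ratio D b x y \<le> gap_ratio D b ((1 - t) *\<^sub>R x + t *\<^sub>R x') y"
proof -
  have "gap_ratio D b x y \<le> gap_ratio D b ((1 - t) *\<^sub>R x + t *\<^sub>R x') y / (1 - t)"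
  proof (rule gap_ratio_least)
    fix a assume a: "a \<in> polar_at D b"
    have "(1 - t) * gap b a x \<le> gap b a ((1 - t) *\<^sub>R x + t *\<^sub>R x')"
      using gap_nonneg[OF a assms(2)] assms(5) by (simp add: gap_affine)
    then have "(1 - t) * gap b a x / gap b a y \<le> gap b a ((1 - t) *\<^sub>R x + t *\<^sub>R x') / gap b a y"
      using gap_pos[OF a assms(4)] by (intro divide_right_mono) auto
    also have "\<dots> \<le> gap_ratio D b ((1 - t) *\<^sub>R x + t *\<^sub>R x') y"
      using a assms by (intro gap_ratio_upper) auto
    finally show "gap b a x / gap b a y \<le> gap_ratio D b ((1 - t) *\<^sub>R x + t *\<^sub>R x') y / (1 - t)"
      using assms(6) by (simp add: field_simps)
  qed
  then show ?thesis using assms(6) by (simp add: field_simps)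
qed

section \<open>Chords and the formula for the Hilbert distance\<close>

text \<open>Nonnegativity at \<open>z\<close> bounds every ratio, and a functional that vanishes at
  \<open>z\<close> attains the bound.\<close>

lemma gap_ratio_chord:
  assumes "x \<in> D" "y \<in> D" "x \<noteq> y" "z \<in> frontier D" "0 < u" "u < 1" "y = (1 - u) *\<^sub>R x + u *\<^sub>R z"
  shows "gap_ratio D b x y = 1 / (1 - u)"
proof (rule antisym)
  have zc: "z \<in> closure D" using assms(4) by (simp add: frontier_def)
  show "gap_ratio D b x y \<le> 1 / (1 - u)"
  proof (rule gap_ratio_least)
    fix a assume a: "a \<in> polar_at D b"
    have "(1 - u) * gap b a x \<le> gap b a y"
      using gap_nonneg[OF a zc] assms(5) by (simp add: assms(7) gap_affine)
    then show "gap b a x / gap b a y \<le> 1 / (1 - u)"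
      using gap_pos[OF a assms(2)] assms(6) by (simp add: field_simps)
  qed
  obtain a where a: "a \<in> polar_at D b" "gap b a z = 0"
    using supporting_gap[OF assms(4)] .
  have "gap b a y = (1 - u) * gap b a x"
    using a(2) by (simp add: assms(7) gap_affine)
  then have "gap b a x / gap b a y = 1 / (1 - u)"
    using gap_pos[OF a(1) assms(1)] by simp
  then show "1 / (1 - u) \<le> gap_ratio D b x y"
    using gap_ratio_upper[OF a(1), of x y] assms closure_subset[of D] by auto
qed

lemma dist_chord:
  fixes x z :: 'a
  assumes "y = (1 - u) *\<^sub>R x + u *\<^sub>R z" "0 < u" "u < 1" "x \<noteq> z"
  shows "dist z x / dist z y = 1 / (1 - u)"
proof -
  have "z - y = (1 - u) *\<^sub>R (z - x)"
    by (simp add: assms(1) algebra_simps)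
  then show ?thesis using assms by (simp add: dist_norm)
qed

lemma chord_end_ratio:
  assumes "x \<in> D" "y \<in> D" "x \<noteq> y" "z \<in> frontier D" "y \<in> open_segment x z"
  shows "dist z x / dist z y = gap_ratio D b x y"
proof -
  obtain u where u: "0 < u" "u < 1" "y = (1 - u) *\<^sub>R x + u *\<^sub>R z" and "x \<noteq> z"
    using assms(5) by (auto simp: in_segment)
  then show ?thesis
    using gap_ratio_chord[OF assms(1-4) u] dist_chord[OF u(3,1,2)] by simp
qed

text \<open>The ray from \<open>x\<close> through \<open>y\<close> is followed beyond
  \<open>y\<close> until it meets the frontier of the bounded set \<open>D\<close>.\<close>

lemma chord_end_exists:
  assumes "x \<in> D" "y \<in> D" "x \<noteq> y"
  shows "\<exists>z\<in>frontier D. y \<in> open_segment x z"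
proof -
  have "y \<in> interior D" "y - x \<noteq> 0"
    using assms "open" by (auto simp: interior_open)
  then obtain d where d: "0 < d" "y + d *\<^sub>R (y - x) \<in> frontier D"
    using ray_to_frontier[OF bounded] by metis
  define z where "z = y + d *\<^sub>R (y - x)"
  have "z - x = (1 + d) *\<^sub>R (y - x)" by (simp add: z_def algebra_simps)
  then have "y - x = (1 / (1 + d)) *\<^sub>R (z - x)" using d by simp
  then have "y = (1 - 1 / (1 + d)) *\<^sub>R x + (1 / (1 + d)) *\<^sub>R z"
    by (simp add: algebra_simps)
  moreover have "x \<noteq> z" using \<open>z - x = _\<close> d assms by auto
  ultimately have "y \<in> open_segment x z"
    unfolding in_segment using d by (intro conjI exI[of _ "1 / (1 + d)"]) auto
  then show ?thesis using d z_def by blast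
qed

text \<open>The parameter of \<open>y\<close> on the chord from \<open>x\<close> to \<open>z\<close> is recovered from \<open>gap_ratio D b x y\<close>.\<close>

lemma chord_end_unique:
  assumes "x \<in> D" "y \<in> D" "x \<noteq> y" "z \<in> frontier D" "y \<in> open_segment x z"
    "z' \<in> frontier D" "y \<in> open_segment x z'"
  shows "z = z'"
proof -
  obtain u where u: "0 < u" "u < 1" "y = (1 - u) *\<^sub>R x + u *\<^sub>R z"
    using assms(5) by (auto simp: in_segment)
  obtain v where v: "0 < v" "v < 1" "y = (1 - v) *\<^sub>R x + v *\<^sub>R z'"
    using assms(7) by (auto simp: in_segment)
  have "1 / (1 - u) = 1 / (1 - v)"
    using gap_ratio_chord[OF assms(1-4) u] gap_ratio_chord[OF assms(1-3,6) v] by simp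
  then have "u = v" by simp
  then show ?thesis using u v by simp
qed

text \<open>The cross ratio splits into one factor for each end of the chord, and each factor is a
  ratio supremum.\<close>

lemma hilbert_dist_eq:
  assumes "x \<in> D" "y \<in> D"
  shows "hilbert_dist D x y = ln (gap_ratio D b x y * gap_ratio D b y x)"
proof (cases "x = y")
  case True
  then show ?thesis using assms by (simp add: hilbert_dist_def gap_ratio_self)
next
  case False
  obtain z where z: "z \<in> frontier D" "y \<in> open_segment x z"
    using chord_end_exists[OF assms False] by blast
  obtain w where w: "w \<in> frontier D" "x \<in> open_segment y w"
    using chord_end_exists[OF assms(2,1)] False by metis
  \<comment> \<open>The definite description is legitimate: \<open>z\<close> is the chord end beyond
    \<open>y\<close>, \<open>w\<close> is the one beyond \<open>x\<close>, and each is
    unique.\<close>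
  have "(THE (w, z). w \<in> frontier D \<and> z \<in> frontier D \<and>
                x \<in> open_segment w y \<and> y \<in> open_segment x z) = (w, z)"
  proof (rule the_equality)
    show "case (w, z) of (w, z) \<Rightarrow> w \<in> frontier D \<and> z \<in> frontier D \<and>
                x \<in> open_segment w y \<and> y \<in> open_segment x z"
      using z w by (simp add: open_segment_commute)
  next
    fix p
    assume p: "case p of (w, z) \<Rightarrow> w \<in> frontier D \<and> z \<in> frontier D \<and>
                x \<in> open_segment w y \<and> y \<in> open_segment x z"
    obtain w' z' where [simp]: "p = (w', z')" by fastforce
    from p have p: "w' \<in> frontier D" "z' \<in> frontier D" "x \<in> open_segment y w'" "y \<in> open_segment x z'"
      by (auto simp: open_segment_commute)
    show "p = (w, z)"
      using chord_end_unique[OF assms False z p(2,4)]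
        chord_end_unique[OF assms(2,1) False[symmetric] w p(1,3)] by simp
  qed
  then have "hilbert_dist D x y = ln ((dist z x / dist z y) * (dist w y / dist w x))"
    using False by (simp add: hilbert_dist_def)
  then show ?thesis
    using chord_end_ratio[OF assms False z] chord_end_ratio[OF assms(2,1) False[symmetric] w]
    by simp
qed

section \<open>Continuity of the ratio supremum and of the distance\<close>

text \<open>For fixed \<open>y\<close> the ratios are Lipschitz in the first argument, with the
  constant \<open>R / e\<close> common to all functionals, so the supremum is Lipschitz up to the
  frontier.\<close>

lemma gap_ratio_tendsto:
  assumes "\<And>n. s n \<in> D" "s \<longlonglongrightarrow> \<xi>" "y \<in> D"
  shows "(\<lambda>n. gap_ratio D b (s n) y) \<longlonglongrightarrow> gap_ratio D b \<xi> y"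
proof -
  have xi: "\<xi> \<in> closure D"
    using assms(1,2) closure_sequential by blast
  obtain R where R: "R > 0" "\<And>a. a \<in> polar_at D b \<Longrightarrow> norm a \<le> R"
    using polar_at_bounded by blast
  obtain e where e: "e > 0" "\<And>a. a \<in> polar_at D b \<Longrightarrow> e \<le> gap b a y"
    using gap_lower_bound[OF assms(3)] by blast
  have *: "gap_ratio D b p y \<le> gap_ratio D b q y + R / e * norm (p - q)"
    if pq: "p \<in> closure D" "q \<in> closure D" for p q
  proof (rule gap_ratio_least)
    fix a assume a: "a \<in> polar_at D b"
    have "gap b a p - gap b a q \<le> norm a * norm (p - q)"
      using gap_diff_le[of b a p q] by simp
    also have "\<dots> \<le> R * norm (p - q)"
      using R(2)[OF a] by (simp add: mult_right_mono)
    finally have "(gap b a p - gap b a q) / gap b a y \<le> R * norm (p - q) / gap b a y"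
      using e(1) e(2)[OF a] by (intro divide_right_mono) auto
    also have "\<dots> \<le> R * norm (p - q) / e"
      using e(1) e(2)[OF a] R(1) by (intro divide_left_mono) auto
    finally show "gap b a p / gap b a y \<le> gap_ratio D b q y + R / e * norm (p - q)"
      using gap_ratio_upper[OF a pq(2) assms(3)] by (simp add: diff_divide_distrib)
  qed
  have s: "s n \<in> closure D" for n using assms(1) closure_subset by blast
  have "norm (gap_ratio D b (s n) y - gap_ratio D b \<xi> y) \<le> R / e * norm (s n - \<xi>)" for n
    using *[OF s xi, of n] *[OF xi s, of n] by (auto simp: norm_minus_commute abs_le_iff)
  moreover have "(\<lambda>n. R / e * norm (s n - \<xi>)) \<longlonglongrightarrow> 0"
    using assms(2) by (intro tendsto_mult_right_zero tendsto_norm_zero) (simp add: LIM_zero_iff)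
  ultimately have "(\<lambda>n. gap_ratio D b (s n) y - gap_ratio D b \<xi> y) \<longlonglongrightarrow> 0"
    by (rule Lim_null_comparison[OF always_eventually[OF allI]])
  then show ?thesis by (simp add: LIM_zero_iff)
qed

lemma gap_ratio_tendsto_1:
  assumes "\<And>n. s n \<in> D" "s \<longlonglongrightarrow> p" "p \<in> D"
  shows "(\<lambda>n. gap_ratio D b p (s n)) \<longlonglongrightarrow> 1"
proof -
  obtain R where R: "R > 0" "\<And>a. a \<in> polar_at D b \<Longrightarrow> norm a \<le> R"
    using polar_at_bounded by blast
  obtain e where e: "e > 0" "\<And>a. a \<in> polar_at D b \<Longrightarrow> e \<le> gap b a p"
    using gap_lower_bound[OF assms(3)] by blast
  \<comment> \<open>This bounds the change of every functional in the polar body between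
    \<open>p\<close> and \<open>s n\<close>.\<close>
  define \<delta> where "\<delta> n = R * norm (s n - p)" for n
  have \<delta>: "\<delta> \<longlonglongrightarrow> 0"
    unfolding \<delta>_def
    using assms(2) by (intro tendsto_mult_right_zero tendsto_norm_zero) (simp add: LIM_zero_iff)
  have upper: "gap_ratio D b p (s n) \<le> 1 + \<delta> n / (e - \<delta> n)" if "\<delta> n < e" for n
  proof (rule gap_ratio_least)
    fix a assume a: "a \<in> polar_at D b"
    have "\<bar>gap b a (s n) - gap b a p\<bar> \<le> \<delta> n"
      using gap_diff_le[of b a "s n" p] mult_right_mono[OF R(2)[OF a], of "norm (s n - p)"]
      by (simp add: \<delta>_def)
    then have *: "gap b a p - gap b a (s n) \<le> \<delta> n" "e - \<delta> n \<le> gap b a (s n)"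
      using e(2)[OF a] by auto
    have "(gap b a p - gap b a (s n)) / gap b a (s n) \<le> \<delta> n / gap b a (s n)"
      using * that by (intro divide_right_mono) auto
    also have "\<dots> \<le> \<delta> n / (e - \<delta> n)"
      using * that R(1) by (intro divide_left_mono) (auto simp: \<delta>_def)
    finally show "gap b a p / gap b a (s n) \<le> 1 + \<delta> n / (e - \<delta> n)"
      using gap_pos[OF a assms(1)[of n]] by (simp add: diff_divide_distrib)
  qed
  have "(\<lambda>n. 1 + \<delta> n / (e - \<delta> n)) \<longlonglongrightarrow> 1 + 0 / (e - 0)"
    using \<delta> e(1) by (intro tendsto_intros) auto
  then have lim: "(\<lambda>n. 1 + \<delta> n / (e - \<delta> n)) \<longlonglongrightarrow> 1" by simp
  show ?thesis
  proof (rule tendsto_sandwich[OF _ _ tendsto_const lim])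
    show "\<forall>\<^sub>F n in sequentially. 1 \<le> gap_ratio D b p (s n)"
      using gap_ratio_ge_1 assms closure_subset by (intro always_eventually) blast
    show "\<forall>\<^sub>F n in sequentially. gap_ratio D b p (s n) \<le> 1 + \<delta> n / (e - \<delta> n)"
      using order_tendstoD(2)[OF \<delta> e(1)] by eventually_elim (rule upper)
  qed
qed

text \<open>Two triangle inequalities through \<open>p\<close> and \<open>s n\<close> squeeze the
  ratio; the correction factors tend to 1.\<close>

lemma gap_ratio_tendsto_right:
  assumes "\<And>n. s n \<in> D" "s \<longlonglongrightarrow> p" "p \<in> D" "y \<in> D"
  shows "(\<lambda>n. gap_ratio D b y (s n)) \<longlonglongrightarrow> gap_ratio D b y p"
proof (rule tendsto_sandwich)
  have c: "y \<in> closure D" "p \<in> closure D" "s n \<in> closure D" for n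
    using assms closure_subset by blast+
  note ge_1 = gap_ratio_ge_1[OF c(2) assms(1)] gap_ratio_ge_1[OF c(3) assms(3)]
  show "\<forall>\<^sub>F n in sequentially. gap_ratio D b y p / gap_ratio D b (s n) p \<le> gap_ratio D b y (s n)"
    using gap_ratio_triangle[OF c(1) assms(1,3)] ge_1(2)
    by (intro always_eventually allI) (simp add: divide_le_eq less_le_trans[OF zero_less_one])
  show "\<forall>\<^sub>F n in sequentially. gap_ratio D b y (s n) \<le> gap_ratio D b y p * gap_ratio D b p (s n)"
    using gap_ratio_triangle[OF c(1) assms(3,1)] by (intro always_eventually allI)
  have "(\<lambda>n. gap_ratio D b y p / gap_ratio D b (s n) p) \<longlonglongrightarrow> gap_ratio D b y p / gap_ratio D b p p"
    using assms gap_ratio_self by (intro tendsto_intros gap_ratio_tendsto) auto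
  then show "(\<lambda>n. gap_ratio D b y p / gap_ratio D b (s n) p) \<longlonglongrightarrow> gap_ratio D b y p"
    using assms gap_ratio_self by simp
  show "(\<lambda>n. gap_ratio D b y p * gap_ratio D b p (s n)) \<longlonglongrightarrow> gap_ratio D b y p"
    using tendsto_mult[OF tendsto_const gap_ratio_tendsto_1[OF assms(1-3)], of "gap_ratio D b y p"]
    by simp
qed

lemma hilbert_dist_tendsto:
  assumes "\<And>n. s n \<in> D" "s \<longlonglongrightarrow> p" "p \<in> D" "y \<in> D"
  shows "(\<lambda>n. hilbert_dist D y (s n)) \<longlonglongrightarrow> hilbert_dist D y p"
proof -
  have c: "y \<in> closure D" "p \<in> closure D"
    using assms closure_subset by blast+
  have "gap_ratio D b y p * gap_ratio D b p y \<noteq> 0"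
    using gap_ratio_ge_1[OF c(1) assms(3)] gap_ratio_ge_1[OF c(2) assms(4)] by simp
  then have "(\<lambda>n. ln (gap_ratio D b y (s n) * gap_ratio D b (s n) y)) \<longlonglongrightarrow>
      ln (gap_ratio D b y p * gap_ratio D b p y)"
    using assms by (intro tendsto_ln tendsto_mult gap_ratio_tendsto gap_ratio_tendsto_right)
  then show ?thesis using assms by (simp add: hilbert_dist_eq)
qed

section \<open>Bounds for the limit function along a segment towards the frontier\<close>

text \<open>Exponentiation separates two factors. The second converges by continuity up to the
  frontier; the first, whose terms may blow up, is only estimated later.\<close>

lemma exp_hilbert_diff_tendsto:
  assumes "\<And>n. s n \<in> D" "hilbert_converges_to D b s g" "y \<in> D"
  shows "(\<lambda>n. (gap_ratio D b y (s n) / gap_ratio D b b (s n)) *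
      (gap_ratio D b (s n) y / gap_ratio D b (s n) b)) \<longlonglongrightarrow> exp (g y)"
proof -
  have c: "y \<in> closure D" "b \<in> closure D" "s n \<in> closure D" for n
    using assms base closure_subset by blast+
  have "(gap_ratio D b y (s n) / gap_ratio D b b (s n)) *
      (gap_ratio D b (s n) y / gap_ratio D b (s n) b) =
      exp (hilbert_dist D y (s n) - hilbert_dist D b (s n))" for n
    using gap_ratio_ge_1[OF c(1) assms(1)[of n]] gap_ratio_ge_1[OF c(2) assms(1)[of n]]
      gap_ratio_ge_1[OF c(3)[of n] assms(3)] gap_ratio_ge_1[OF c(3)[of n] base]
    by (simp add: hilbert_dist_eq assms base exp_diff)
  moreover have "(\<lambda>n. exp (hilbert_dist D y (s n) - hilbert_dist D b (s n))) \<longlonglongrightarrow> exp (g y)"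
    using assms(2,3) unfolding hilbert_converges_to_def by (intro tendsto_exp) blast
  ultimately show ?thesis by simp
qed

lemma segment_to_closure:
  assumes "\<xi> \<in> closure D" "0 < t" "t < 1"
  shows "(1 - t) *\<^sub>R b + t *\<^sub>R \<xi> \<in> D"
proof -
  have "\<xi> - (1 - t) *\<^sub>R (\<xi> - b) \<in> interior D"
    using convex assms base "open" by (intro mem_interior_closure_convex_shrink) (auto simp: interior_open)
  moreover have "\<xi> - (1 - t) *\<^sub>R (\<xi> - b) = (1 - t) *\<^sub>R b + t *\<^sub>R \<xi>"
    by (simp add: algebra_simps)
  ultimately show ?thesis using interior_subset by force
qed

text \<open>Near \<open>\<xi>\<close> the ratio at \<open>\<xi>\<close> is negligible against the
  ratio at \<open>b\<close>, so by convexity the first factor is at most \<open>1 - t\<close> in the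
  limit. The second is bounded using \<open>gap b a y \<ge> t * gap b a \<xi>\<close>.\<close>

lemma exp_limit_upper:
  assumes s: "\<And>n. s n \<in> D" "s \<longlonglongrightarrow> \<xi>" and xi: "\<xi> \<in> frontier D"
    and g: "hilbert_converges_to D b s g" and t: "0 < t" "t < 1"
  shows "exp (g ((1 - t) *\<^sub>R b + t *\<^sub>R \<xi>)) \<le> (1 - t) / (t * gap_ratio D b \<xi> b)"
proof -
  define y where "y = (1 - t) *\<^sub>R b + t *\<^sub>R \<xi>"
  have c: "\<xi> \<in> closure D" "b \<in> closure D" "s n \<in> closure D" for n
    using s xi base closure_subset by (auto simp: frontier_def)
  have y: "y \<in> D" unfolding y_def using c(1) t by (rule segment_to_closure)
  obtain R where R: "R > 0" "\<And>a. a \<in> polar_at D b \<Longrightarrow> norm a \<le> R"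
    using polar_at_bounded by blast
  \<comment> \<open>Since \<open>a0\<close> vanishes at \<open>\<xi>\<close>, the values
    \<open>gap b a0 (s n)\<close> tend to 0, which forces \<open>gap_ratio D b b (s n)\<close> to
    infinity.\<close>
  obtain a0 where a0: "a0 \<in> polar_at D b" "gap b a0 \<xi> = 0"
    using supporting_gap[OF xi] .
  note ge_1 = gap_ratio_ge_1[OF c(2) s(1)]
  have pos: "0 < gap_ratio D b b (s n)" for n using ge_1[of n] by linarith
  have xi_n: "gap_ratio D b \<xi> (s n) \<le> 1 + R * norm (\<xi> - s n) * gap_ratio D b b (s n)" for n
  proof (rule gap_ratio_least)
    fix a assume a: "a \<in> polar_at D b"
    have "gap b a \<xi> - gap b a (s n) \<le> norm a * norm (\<xi> - s n)"
      using gap_diff_le[of b a \<xi> "s n"] by simp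
    also have "\<dots> \<le> R * norm (\<xi> - s n)"
      using R(2)[OF a] by (simp add: mult_right_mono)
    finally have "(gap b a \<xi> - gap b a (s n)) / gap b a (s n) \<le> R * norm (\<xi> - s n) / gap b a (s n)"
      using gap_pos[OF a s(1)[of n]] by (intro divide_right_mono) auto
    \<comment> \<open>The normalisation at \<open>b\<close> turns the reciprocal of
      \<open>gap b a (s n)\<close> into a ratio.\<close>
    also have "\<dots> = R * norm (\<xi> - s n) * (gap b a b / gap b a (s n))" by simp
    also have "\<dots> \<le> R * norm (\<xi> - s n) * gap_ratio D b b (s n)"
      using R(1) a c s by (intro mult_left_mono gap_ratio_upper) auto
    finally show "gap b a \<xi> / gap b a (s n) \<le> 1 + R * norm (\<xi> - s n) * gap_ratio D b b (s n)"
      using gap_pos[OF a s(1)[of n]] by (simp add: diff_divide_distrib)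
  qed
  have bound: "gap_ratio D b y (s n) / gap_ratio D b b (s n)
      \<le> (1 - t) + t * (gap b a0 (s n) + R * norm (\<xi> - s n))" for n
  proof -
    \<comment> \<open>This absorbs the leading 1 of \<open>xi_n\<close> into a small multiple of
      \<open>gap_ratio D b b (s n)\<close>.\<close>
    have "1 \<le> gap b a0 (s n) * gap_ratio D b b (s n)"
      using gap_ratio_upper[OF a0(1) c(2) s(1)[of n]] gap_pos[OF a0(1) s(1)[of n]]
      by (simp add: divide_le_eq mult.commute)
    then have "gap_ratio D b \<xi> (s n) \<le> (gap b a0 (s n) + R * norm (\<xi> - s n)) * gap_ratio D b b (s n)"
      using xi_n[of n] by (simp add: algebra_simps)
    then have "t * gap_ratio D b \<xi> (s n)
        \<le> t * ((gap b a0 (s n) + R * norm (\<xi> - s n)) * gap_ratio D b b (s n))"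
      using t by (intro mult_left_mono) auto
    then have "gap_ratio D b y (s n)
        \<le> ((1 - t) + t * (gap b a0 (s n) + R * norm (\<xi> - s n))) * gap_ratio D b b (s n)"
      using gap_ratio_convex[OF c(2,1) s(1)[of n], of t] t by (simp add: y_def algebra_simps)
    then show ?thesis using pos[of n] by (simp add: divide_le_eq)
  qed
  have "exp (g y) \<le> ((1 - t) + t * (0 + R * 0)) * (gap_ratio D b \<xi> y / gap_ratio D b \<xi> b)"
  proof (rule LIMSEQ_le[OF exp_hilbert_diff_tendsto[OF s(1) g y]])
    have "(\<lambda>n. gap b a0 (s n)) \<longlonglongrightarrow> 0"
      using continuous_on_tendsto_compose[OF continuous_gap s(2), of b a0] a0(2) by simp
    moreover have "(\<lambda>n. norm (\<xi> - s n)) \<longlonglongrightarrow> 0"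
      using tendsto_norm[OF tendsto_diff[OF tendsto_const[of \<xi>] s(2)]] by simp
    moreover have "gap_ratio D b \<xi> b \<noteq> 0" using gap_ratio_ge_1[OF c(1) base] by auto
    ultimately show "(\<lambda>n. ((1 - t) + t * (gap b a0 (s n) + R * norm (\<xi> - s n))) *
        (gap_ratio D b (s n) y / gap_ratio D b (s n) b)) \<longlonglongrightarrow>
        ((1 - t) + t * (0 + R * 0)) * (gap_ratio D b \<xi> y / gap_ratio D b \<xi> b)"
      using s y base by (intro tendsto_intros gap_ratio_tendsto)
    have "0 \<le> gap_ratio D b (s n) y / gap_ratio D b (s n) b" for n
      using gap_ratio_ge_1[OF c(3)[of n] y] gap_ratio_ge_1[OF c(3)[of n] base] by simp
    then show "\<exists>N. \<forall>n\<ge>N. gap_ratio D b y (s n) / gap_ratio D b b (s n) *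
        (gap_ratio D b (s n) y / gap_ratio D b (s n) b)
        \<le> ((1 - t) + t * (gap b a0 (s n) + R * norm (\<xi> - s n))) *
          (gap_ratio D b (s n) y / gap_ratio D b (s n) b)"
      using mult_right_mono[OF bound] by blast
  qed
  also have "\<dots> = (1 - t) * (gap_ratio D b \<xi> y / gap_ratio D b \<xi> b)" by simp
  also have "\<dots> \<le> (1 - t) * ((1 / t) / gap_ratio D b \<xi> b)"
  proof (intro mult_left_mono divide_right_mono gap_ratio_least)
    fix a assume a: "a \<in> polar_at D b"
    have "t * gap b a \<xi> \<le> gap b a y" using t by (simp add: y_def gap_affine)
    then show "gap b a \<xi> / gap b a y \<le> 1 / t"
      using t gap_pos[OF a y] by (simp add: field_simps)
  qed (use t gap_ratio_ge_1[OF c(1) base] in auto)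
  finally show ?thesis by (simp add: y_def)
qed

text \<open>The point lies on the segment from \<open>b\<close>, so
  \<open>gap_ratio_scale_lower\<close> bounds the first factor below by \<open>1 - t\<close> for
  every \<open>n\<close>; the second factor converges.\<close>

lemma exp_limit_lower:
  assumes s: "\<And>n. s n \<in> D" "s \<longlonglongrightarrow> \<eta>" and xi: "\<xi> \<in> closure D"
    and g: "hilbert_converges_to D b s g" and t: "0 < t" "t < 1"
  shows "(1 - t) * (gap_ratio D b \<eta> ((1 - t) *\<^sub>R b + t *\<^sub>R \<xi>) / gap_ratio D b \<eta> b)
      \<le> exp (g ((1 - t) *\<^sub>R b + t *\<^sub>R \<xi>))"
proof -
  define y where "y = (1 - t) *\<^sub>R b + t *\<^sub>R \<xi>"
  have y: "y \<in> D" unfolding y_def using xi t by (rule segment_to_closure)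
  have c: "y \<in> closure D" "b \<in> closure D" "s n \<in> closure D" for n
    using s y base closure_subset by auto
  have eta: "\<eta> \<in> closure D" using s closure_sequential by blast
  have bound: "1 - t \<le> gap_ratio D b y (s n) / gap_ratio D b b (s n)" for n
    using gap_ratio_scale_lower[OF c(2) xi _ s(1)[of n], of t] c(1) t
      gap_ratio_ge_1[OF c(2) s(1)[of n]]
    by (simp add: y_def pos_le_divide_eq)
  have "(1 - t) * (gap_ratio D b \<eta> y / gap_ratio D b \<eta> b) \<le> exp (g y)"
  proof (rule LIMSEQ_le[OF _ exp_hilbert_diff_tendsto[OF s(1) g y]])
    have "gap_ratio D b \<eta> b \<noteq> 0" using gap_ratio_ge_1[OF eta base] by auto
    then show "(\<lambda>n. (1 - t) * (gap_ratio D b (s n) y / gap_ratio D b (s n) b)) \<longlonglongrightarrow>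
        (1 - t) * (gap_ratio D b \<eta> y / gap_ratio D b \<eta> b)"
      using s y base by (intro tendsto_intros gap_ratio_tendsto)
    have "0 \<le> gap_ratio D b (s n) y / gap_ratio D b (s n) b" for n
      using gap_ratio_ge_1[OF c(3)[of n] y] gap_ratio_ge_1[OF c(3)[of n] base] by simp
    then show "\<exists>N. \<forall>n\<ge>N. (1 - t) * (gap_ratio D b (s n) y / gap_ratio D b (s n) b)
        \<le> gap_ratio D b y (s n) / gap_ratio D b b (s n) *
          (gap_ratio D b (s n) y / gap_ratio D b (s n) b)"
      using mult_right_mono[OF bound] by blast
  qed
  then show ?thesis by (simp add: y_def)
qed

section \<open>Comparison of two limit points\<close>

text \<open>Both sequences define the same \<open>g\<close>, so the lower bound from
  \<open>s'\<close> and the upper bound from \<open>s\<close> meet at the same point near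
  \<open>\<xi>\<close>.\<close>

lemma gap_comparison:
  assumes s: "\<And>n. s n \<in> D" "s \<longlonglongrightarrow> \<xi>" "\<xi> \<in> frontier D" "hilbert_converges_to D b s g"
    and s': "\<And>n. s' n \<in> D" "s' \<longlonglongrightarrow> \<eta>" "hilbert_converges_to D b s' g"
    and a: "a \<in> polar_at D b"
  shows "gap b a \<eta> * gap_ratio D b \<xi> b \<le> gap b a \<xi> * gap_ratio D b \<eta> b"
proof -
  have c: "\<xi> \<in> closure D" "\<eta> \<in> closure D"
    using s s' closure_sequential by blast+
  define P where "P = gap_ratio D b \<xi> b"
  define Q where "Q = gap_ratio D b \<eta> b"
  have PQ: "P > 0" "Q > 0"
    using gap_ratio_ge_1[OF c(1) base] gap_ratio_ge_1[OF c(2) base] by (auto simp: P_def Q_def)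
  have *: "t * (gap b a \<eta> * P) \<le> ((1 - t) + t * gap b a \<xi>) * Q" if t: "0 < t" "t < 1" for t
  proof -
    define y where "y = (1 - t) *\<^sub>R b + t *\<^sub>R \<xi>"
    have y: "y \<in> D" unfolding y_def using c(1) t by (rule segment_to_closure)
    have "(1 - t) * (gap b a \<eta> / gap b a y / Q) \<le> (1 - t) * (gap_ratio D b \<eta> y / Q)"
      using t PQ y c a by (intro mult_left_mono divide_right_mono gap_ratio_upper) auto
    also have "\<dots> \<le> exp (g y)"
      unfolding y_def Q_def using s'(1,2) c(1) s'(3) t by (rule exp_limit_lower)
    also have "\<dots> \<le> (1 - t) / (t * P)"
      unfolding y_def P_def using s t by (rule exp_limit_upper)
    finally have "(1 - t) * (gap b a \<eta> / gap b a y / Q) \<le> (1 - t) * (1 / (t * P))" by simp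
    \<comment> \<open>Both bounds vanish to the same order as \<open>t\<close> tends to 1;
      cancelling \<open>1 - t\<close> keeps the information.\<close>
    then have "gap b a \<eta> / gap b a y / Q \<le> 1 / (t * P)"
      using t by (subst (asm) mult_le_cancel_left_pos) auto
    \<comment> \<open>Denominators are cleared before the limit, since \<open>gap b a \<xi>\<close>
      may be 0.\<close>
    then have "t * (gap b a \<eta> * P) \<le> gap b a y * Q"
      using t PQ gap_pos[OF a y] by (simp add: field_simps)
    then show ?thesis by (simp add: y_def gap_affine)
  qed
  have "gap b a \<eta> * P \<le> gap b a \<xi> * Q"
  proof (rule tendsto_le[OF trivial_limit_at_left_real])
    show "((\<lambda>t. t * (gap b a \<eta> * P)) \<longlongrightarrow> gap b a \<eta> * P) (at_left 1)"
      by (auto intro!: tendsto_eq_intros)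
    show "((\<lambda>t. ((1 - t) + t * gap b a \<xi>) * Q) \<longlongrightarrow> gap b a \<xi> * Q) (at_left 1)"
      by (auto intro!: tendsto_eq_intros)
    show "\<forall>\<^sub>F t in at_left 1. t * (gap b a \<eta> * P) \<le> ((1 - t) + t * gap b a \<xi>) * Q"
      using eventually_at_left_real[of 0 1] by (rule eventually_mono) (use * in auto)
  qed
  then show ?thesis by (simp add: P_def Q_def)
qed

lemma frontier_limit_unique:
  assumes s: "\<And>n. s n \<in> D" "s \<longlonglongrightarrow> \<xi>" "\<xi> \<in> frontier D" "hilbert_converges_to D b s g"
    and s': "\<And>n. s' n \<in> D" "s' \<longlonglongrightarrow> \<eta>" "\<eta> \<in> frontier D" "hilbert_converges_to D b s' g"
  shows "\<xi> = \<eta>"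
proof -
  have eq: "gap b a \<eta> * gap_ratio D b \<xi> b = gap b a \<xi> * gap_ratio D b \<eta> b" if "a \<in> polar_at D b" for a
    using gap_comparison[OF s s'(1,2,4) that] gap_comparison[OF s' s(1,2,4) that] by simp
  have "\<xi> \<in> closure D" using s(3) by (simp add: frontier_def)
  then have "gap_ratio D b \<xi> b \<ge> 1" by (rule gap_ratio_ge_1[OF _ base])
  moreover have "gap_ratio D b \<xi> b = gap_ratio D b \<eta> b"
    using eq[of 0] by simp
  ultimately have gap_eq: "gap b a \<eta> = gap b a \<xi>" if "a \<in> polar_at D b" for a
    using eq[OF that] by simp
  obtain r where r: "r > 0" "cball 0 r \<subseteq> polar_at D b"
    using polar_at_neighbourhood by blast
  show ?thesis
  proof (rule ccontr)
    assume ne: "\<xi> \<noteq> \<eta>"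
    \<comment> \<open>The direction separating the two points, scaled to norm \<open>r\<close> so
      that it lies in the polar body.\<close>
    define a where "a = (r / norm (\<xi> - \<eta>)) *\<^sub>R (\<xi> - \<eta>)"
    have "a \<in> polar_at D b"
      using r ne by (intro subsetD[OF r(2)]) (simp add: a_def)
    from gap_eq[OF this] have "a \<bullet> (\<xi> - \<eta>) = 0"
      by (simp add: gap_def algebra_simps)
    then show False using r ne by (simp add: a_def)
  qed
qed

section \<open>Passage to subsequences and conclusion\<close>

lemma hilbert_converges_to_subseq:
  "hilbert_converges_to D b s g \<Longrightarrow> strict_mono r \<Longrightarrow> hilbert_converges_to D b (s \<circ> r) g"
  unfolding hilbert_converges_to_def
  using LIMSEQ_subseq_LIMSEQ[of "\<lambda>n. hilbert_dist D _ (s n) - hilbert_dist D b (s n)" _ r]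
  by (simp add: o_def)

text \<open>With a limit \<open>p\<close> in \<open>D\<close>, continuity of the distance would make
  \<open>g\<close> the normalised distance to \<open>p\<close>, which a horofunction is not.\<close>

lemma horofunction_limit_in_frontier:
  assumes s: "\<And>n. s n \<in> D" "s \<longlonglongrightarrow> p" and g: "hilbert_converges_to D b s g" "horofunction D b g"
  shows "p \<in> frontier D"
proof -
  have "p \<notin> D"
  proof
    assume p: "p \<in> D"
    have "g y = hilbert_dist D y p - hilbert_dist D b p" if y: "y \<in> D" for y
    proof (rule LIMSEQ_unique)
      show "(\<lambda>n. hilbert_dist D y (s n) - hilbert_dist D b (s n)) \<longlonglongrightarrow> g y"
        using g(1) y unfolding hilbert_converges_to_def by blast
      show "(\<lambda>n. hilbert_dist D y (s n) - hilbert_dist D b (s n))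
          \<longlonglongrightarrow> hilbert_dist D y p - hilbert_dist D b p"
        using s p y base by (intro tendsto_diff hilbert_dist_tendsto)
    qed
    then show False using g(2) p unfolding horofunction_def by blast
  qed
  moreover have "p \<in> closure D" using s closure_sequential by blast
  ultimately show ?thesis using "open" by (simp add: frontier_def interior_open)
qed

end

theorem theorem1p3:
  fixes D :: "'a::euclidean_space set" and b :: 'a
    and xs :: "nat \<Rightarrow> 'a" and g :: "'a \<Rightarrow> real"
  assumes "bounded D" and "convex D" and "open D" and "b \<in> D"
    and "\<forall>n. xs n \<in> D"
    and "hilbert_converges_to D b xs g"
    and "horofunction D b g"
  shows "\<exists>\<xi>\<in>frontier D. (xs \<longlongrightarrow> \<xi>) sequentially"
proof -
  note D = assms(1-4)
  \<comment> \<open>Compactness of the closure yields convergent further subsequences, and the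
    horofunction property puts their limits on the frontier.\<close>
  have subseq: "\<exists>l r'. l \<in> frontier D \<and> strict_mono r' \<and> (xs \<circ> (r \<circ> r')) \<longlonglongrightarrow> l" 
    if "strict_mono r" for r :: "nat \<Rightarrow> nat"
  proof -
    have "seq_compact (closure D)" using assms(1) by (simp add: compact_imp_seq_compact)
    moreover have "\<forall>n. (xs \<circ> r) n \<in> closure D" using assms(5) closure_subset by fastforce
    ultimately obtain l r' where l: "l \<in> closure D" "strict_mono r'" "((xs \<circ> r) \<circ> r') \<longlonglongrightarrow> l"
      by (rule seq_compactE)
    note lim = l(3)[unfolded o_assoc [symmetric]]
    have "hilbert_converges_to D b (xs \<circ> (r \<circ> r')) g"
      using hilbert_converges_to_subseq[OF D assms(6) strict_mono_o[OF that l(2)]] .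
    then have "l \<in> frontier D"
      using assms(5) by (intro horofunction_limit_in_frontier[OF D _ lim _ assms(7)]) auto
    then show ?thesis using l(2) lim by blast
  qed
  have unique: "l = l'"
    if "l \<in> frontier D" "l' \<in> frontier D" "strict_mono r" "strict_mono r'"
      "(xs \<circ> r) \<longlonglongrightarrow> l" "(xs \<circ> r') \<longlonglongrightarrow> l'" for l l' r r'
  proof (rule frontier_limit_unique[OF D])
    show "hilbert_converges_to D b (xs \<circ> r) g" "hilbert_converges_to D b (xs \<circ> r') g"
      using hilbert_converges_to_subseq[OF D assms(6)] that by blast+
  qed (use that assms(5) in auto)
  obtain \<xi> r0 where xi: "\<xi> \<in> frontier D" "strict_mono r0" "(xs \<circ> r0) \<longlonglongrightarrow> \<xi>"
    using subseq[OF strict_mono_id] by auto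
  have "xs \<longlonglongrightarrow> \<xi>"
  \<comment> \<open>Otherwise some subsequence stays at distance at least \<open>e\<close> from
    \<open>\<xi>\<close>, yet a further subsequence of it must converge to \<open>\<xi>\<close> by
    \<open>unique\<close>.\<close>
  proof (rule ccontr)
    assume "\<not> xs \<longlonglongrightarrow> \<xi>"
    then obtain e where e: "e > 0" "\<forall>N. \<exists>n\<ge>N. n \<in> {n. e \<le> dist (xs n) \<xi>}"
      by (auto simp: lim_sequentially not_less)
    have "infinite {n. e \<le> dist (xs n) \<xi>}"
      unfolding infinite_nat_iff_unbounded_le by (fact e(2))
    then obtain r :: "nat \<Rightarrow> nat" where r: "strict_mono r" "\<And>n. e \<le> dist (xs (r n)) \<xi>"
      using infinite_enumerate by blast
    obtain l r' where l: "l \<in> frontier D" "strict_mono r'" "(xs \<circ> (r \<circ> r')) \<longlonglongrightarrow> l"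
      using subseq[OF r(1)] by blast
    have "l = \<xi>"
      using unique[OF l(1) xi(1) strict_mono_o[OF r(1) l(2)] xi(2) l(3) xi(3)] .
    then obtain n where "dist (xs (r (r' n))) \<xi> < e"
      using metric_LIMSEQ_D[OF l(3) e(1)] by auto
    then show False using r(2)[of "r' n"] by simp
  qed
  then show ?thesis using xi(1) by blast
qed

end
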